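(* There exists a repetitive deterministic finite automaton with translucent words (RDFAwtw) $A_{\rm ex}$ over a binary input alphabet such that the language $L(A_{\rm ex})$ is not semi-linear.
   Context: **Automata.** A repetitive finite automaton with translucent words (RNFAwtw) is a tuple $A=(Q,\Sigma,\lhd,\tau,I,\delta)$, where $Q$ is a finite set of states, $\Sigma$ is a finite input alphabet, $\lhd\notin\Sigma$ is an end-of-tape marker, $I\subseteq Q$ is the set of initial states, $\tau$ maps each state to a finite subset of $\Sigma^*$ (its translucent words), and $\delta$ is a transition function with $\delta(q,a)\subseteq Q$ for $q\in Q$, $a\in\Sigma$, and with $\delta(q,\lhd)$ either a subset of $Q$ or an element of $\{\mathsf{Accept},\mathsf{Reject}\}$ for $q\in Q$. Put $\Sigma_q=\{a\in\Sigma\mid\delta(q,a)\neq\emptyset\}$. It is required for each $q$ that, if $\tau(q)\ne\emptyset$, then $\tau(q)$ is a finite prefix code (a set of non-empty words none of which is a proper prefix of another one), and that no word of $\tau(q)$ begins with a letter of $\Sigma_q$. **Computations.** Configurations are words $qw\cdot\lhd$ ($q\in Q$, $w\in\Sigma^*$), together with $\mathsf{Accept}$ and $\mathsf{Reject}$. The single-step relation $\vdash_A$ on $qw\cdot\lhd$ is: - if $w=uav$ with $u\in(\tau(q))^*$, $a\in\Sigma_q$, $v\in\Sigma^*$, then $qw\cdot\lhd\vdash_A q'uv\cdot\lhd$ for each $q'\in\delta(q,a)$; - if $w=uav$ with $u\in(\tau(q))^*$, $a\in\Sigma\setminus\Sigma_q$, $v\in\Sigma^*$ and $av\notin\tau(q)\cdot\Sigma^*$,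 then $qw\cdot\lhd\vdash_A\mathsf{Reject}$; - if $w\in(\tau(q))^*$, then $qw\cdot\lhd\vdash_A\mathsf{Accept}$ if $\delta(q,\lhd)=\mathsf{Accept}$; $qw\cdot\lhd\vdash_A\mathsf{Reject}$ if $\delta(q,\lhd)=\mathsf{Reject}$ or $\delta(q,\lhd)=\emptyset$; and $qw\cdot\lhd\vdash_A q'w\cdot\lhd$ for each $q'\in\delta(q,\lhd)$ if $\delta(q,\lhd)\subseteq Q$. $L(A)$ is the set of all $w\in\Sigma^*$ such that $q_0w\cdot\lhd\vdash_A^*\mathsf{Accept}$ for some $q_0\in I$, where $\vdash_A^*$ is the reflexive transitive closure of $\vdash_A$. An RNFAwtw is deterministic (an RDFAwtw) if $|I|=1$, $|\delta(q,a)|\le 1$ for all $q\in Q$, $a\in\Sigma$, and $|\delta(q,\lhd)|\le1$ whenever $\delta(q,\lhd)\subseteq Q$. **Semi-linearity.** A language over an alphabet of $n$ letters is semi-linear if its Parikh image (the set of letter-count vectors of its words) is a semi-linear subset of $\mathbb{N}^n$, i.e. a finite union of sets of the form $\{c+\sum_{i=1}^r k_ip_i\mid k_i\in\mathbb{N}\}$. *)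

theory Defs
  imports Main "HOL-Library.Sublist"
begin

section \<open>Repetitive finite automata with translucent words\<close>

text \<open>
  The end-of-tape marker is not represented as a letter: the values of the transition function
  at the marker are given by the separate component \<open>end_delta\<close>, so the marker can never
  belong to the input alphabet.
\<close>

datatype 'q end_action = Accept | Reject | Continue "'q set"

record ('q, 'a) rnfawtw =
  states :: "'q set"
  alphabet :: "'a set"
  translucent :: "'q \<Rightarrow> 'a list set"
  initial :: "'q set"
  delta :: "'q \<Rightarrow> 'a \<Rightarrow> 'q set"
  end_delta :: "'q \<Rightarrow> 'q end_action"

definition readable :: "('q, 'a) rnfawtw \<Rightarrow> 'q \<Rightarrow> 'a set" where
  "readable A q = {a \<in> alphabet A. delta A q a \<noteq> {}}"

definition prefix_code :: "'a list set \<Rightarrow> bool" where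
  "prefix_code X \<longleftrightarrow> [] \<notin> X \<and> (\<forall>x\<in>X. \<forall>y\<in>X. \<not> strict_prefix x y)"

definition word_star :: "'a list set \<Rightarrow> 'a list set" where
  "word_star X = concat ` lists X"

definition is_rnfawtw :: "('q, 'a) rnfawtw \<Rightarrow> bool" where
  "is_rnfawtw A \<longleftrightarrow>
     finite (states A) \<and>
     finite (alphabet A) \<and>
     initial A \<subseteq> states A \<and>
     (\<forall>q\<in>states A. finite (translucent A q) \<and> translucent A q \<subseteq> lists (alphabet A)) \<and>
     (\<forall>q\<in>states A. \<forall>a\<in>alphabet A. delta A q a \<subseteq> states A) \<and>
     (\<forall>q\<in>states A. \<forall>S. end_delta A q = Continue S \<longrightarrow> S \<subseteq> states A) \<and>
     (\<forall>q\<in>states A. translucent A q \<noteq> {} \<longrightarrow> prefix_code (translucent A q)) \<and>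
     (\<forall>q\<in>states A. \<forall>a\<in>readable A q. \<forall>w. a # w \<notin> translucent A q)"

definition is_rdfawtw :: "('q, 'a) rnfawtw \<Rightarrow> bool" where
  "is_rdfawtw A \<longleftrightarrow>
     is_rnfawtw A \<and>
     card (initial A) = 1 \<and>
     (\<forall>q\<in>states A. \<forall>a\<in>alphabet A. card (delta A q a) \<le> 1) \<and>
     (\<forall>q\<in>states A. \<forall>S. end_delta A q = Continue S \<longrightarrow> card S \<le> 1)"

text \<open>\<open>Conf q w\<close> is the configuration in state \<open>q\<close> with tape content \<open>w\<close> followed by the marker.\<close>

datatype ('q, 'a) config = Conf 'q "'a list" | Accepted | Rejected

inductive step :: "('q, 'a) rnfawtw \<Rightarrow> ('q, 'a) config \<Rightarrow> ('q, 'a) config \<Rightarrow> bool"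
  for A :: "('q, 'a) rnfawtw" where
  read_letter:
    "\<lbrakk>q \<in> states A; u \<in> word_star (translucent A q); a \<in> readable A q; v \<in> lists (alphabet A);
      q' \<in> delta A q a\<rbrakk>
     \<Longrightarrow> step A (Conf q (u @ a # v)) (Conf q' (u @ v))"
| reject_letter:
    "\<lbrakk>q \<in> states A; u \<in> word_star (translucent A q); a \<in> alphabet A - readable A q;
      v \<in> lists (alphabet A);
      a # v \<notin> {x @ y | x y. x \<in> translucent A q \<and> y \<in> lists (alphabet A)}\<rbrakk>
     \<Longrightarrow> step A (Conf q (u @ a # v)) Rejected"
| end_accept:
    "\<lbrakk>q \<in> states A; w \<in> word_star (translucent A q); end_delta A q = Accept\<rbrakk>
     \<Longrightarrow> step A (Conf q w) Accepted"
| end_reject: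
    "\<lbrakk>q \<in> states A; w \<in> word_star (translucent A q);
      end_delta A q = Reject \<or> end_delta A q = Continue {}\<rbrakk>
     \<Longrightarrow> step A (Conf q w) Rejected"
| end_continue:
    "\<lbrakk>q \<in> states A; w \<in> word_star (translucent A q); end_delta A q = Continue S; q' \<in> S\<rbrakk>
     \<Longrightarrow> step A (Conf q w) (Conf q' w)"

definition language :: "('q, 'a) rnfawtw \<Rightarrow> 'a list set" where
  "language A =
     {w \<in> lists (alphabet A). \<exists>q0\<in>initial A. (step A)\<^sup>*\<^sup>* (Conf q0 w) Accepted}"


section \<open>Semi-linearity\<close>

text \<open>
  Vectors of natural numbers whose coordinates are indexed by a finite set \<open>D\<close> are represented
  as functions that vanish outside \<open>D\<close>.
\<close>

definition nat_vectors :: "'a set \<Rightarrow> ('a \<Rightarrow> nat) set" where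
  "nat_vectors D = {v. \<forall>a. a \<notin> D \<longrightarrow> v a = 0}"

definition linear_set :: "'a set \<Rightarrow> ('a \<Rightarrow> nat) set \<Rightarrow> bool" where
  "linear_set D X \<longleftrightarrow>
     (\<exists>c (r::nat) p. c \<in> nat_vectors D \<and> (\<forall>i<r. p i \<in> nat_vectors D) \<and>
        X = {(\<lambda>a. c a + (\<Sum>i<r. k i * p i a)) | k. k \<in> (UNIV :: (nat \<Rightarrow> nat) set)})"

definition semilinear_set :: "'a set \<Rightarrow> ('a \<Rightarrow> nat) set \<Rightarrow> bool" where
  "semilinear_set D X \<longleftrightarrow> (\<exists>F. finite F \<and> (\<forall>Y\<in>F. linear_set D Y) \<and> X = \<Union>F)"

definition parikh :: "'a list \<Rightarrow> 'a \<Rightarrow> nat" where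
  "parikh w = (\<lambda>a. count_list w a)"

definition semilinear_language :: "'a set \<Rightarrow> 'a list set \<Rightarrow> bool" where
  "semilinear_language D L \<longleftrightarrow> semilinear_set D (parikh ` L)"

end

(* Write a = 0 and b = 1.  The automaton alternates between two sweeps.  State 0 turns (ba)^(2n)
   into (aba)^n by deleting every other b, and state 3 turns (aba)^n into (ba)^n by deleting the
   first letter of each block; states 1 and 2 start this second sweep and accept exactly if n = 1.
   State 0 deletes only b's and can be left only on a word (aba)^n, so the number of a's is halved
   in each round whatever the input was.  Hence the numbers of a's in accepted words are the
   powers 2^k with k > 0, a set that contains no infinite arithmetic progression. *)

theory Submission
  imports Defs
begin

section \<open>Semi-linear sets and arithmetic progressions\<close>

text \<open>One of the finitely many linear pieces must already take infinitely many values at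
  \<open>a\<close>. Some period of that piece is then nonzero at \<open>a\<close>, and adding
  multiples of this period alone gives the progression.\<close>

lemma semilinear_set_imp_progression:
  assumes "semilinear_set D X" and "infinite ((\<lambda>v. v a) ` X)"
  shows "\<exists>c d. d > 0 \<and> (\<forall>t. c + t * d \<in> (\<lambda>v. v a) ` X)"
proof -
  obtain F where F: "finite F" "\<forall>Y\<in>F. linear_set D Y" "X = \<Union>F"
    using assms(1) unfolding semilinear_set_def by blast
  have "(\<lambda>v. v a) ` X = (\<Union>Y\<in>F. (\<lambda>v. v a) ` Y)"
    using F(3) by blast
  then obtain Y where Y: "Y \<in> F" "infinite ((\<lambda>v. v a) ` Y)"
    using assms(2) F(1) by auto
  obtain c r p where Y_eq: "Y = {(\<lambda>a. c a + (\<Sum>i<r. k i * p i a)) | k. k \<in> (UNIV :: (nat \<Rightarrow> nat) set)}"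
    using F(2) Y(1) unfolding linear_set_def by meson
  have "\<exists>i<r. p i a \<noteq> 0"
  proof (rule ccontr)
    assume "\<not> (\<exists>i<r. p i a \<noteq> 0)"
    then have "(\<lambda>v. v a) ` Y \<subseteq> {c a}"
      unfolding Y_eq by auto
    then show False
      using Y(2) finite_subset by blast
  qed
  then obtain i where i: "i < r" "p i a \<noteq> 0"
    by blast
  have "c a + t * p i a \<in> (\<lambda>v. v a) ` X" for t
  proof -
    have "(\<Sum>j<r. (if j = i then t else 0) * p j a) = (\<Sum>j<r. if j = i then t * p j a else 0)"
      by (rule sum.cong) auto
    also have "\<dots> = t * p i a"
      using i(1) by simp
    finally have "c a + t * p i a = (\<lambda>a. c a + (\<Sum>j<r. (if j = i then t else 0) * p j a)) a"
      by simp
    moreover have "(\<lambda>a. c a + (\<Sum>j<r. (if j = i then t else 0) * p j a)) \<in> X"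
      unfolding F(3)
    proof (rule UnionI)
      show "Y \<in> F"
        by (fact Y(1))
      show "(\<lambda>a. c a + (\<Sum>j<r. (if j = i then t else 0) * p j a)) \<in> Y"
        unfolding Y_eq by (intro CollectI exI[of _ "\<lambda>j. if j = i then t else 0"]) simp
    qed
    ultimately show ?thesis
      by (rule image_eqI)
  qed
  then show ?thesis
    using i(2) by blast
qed

text \<open>Three terms suffice: since \<open>c\<close> is a power of two and so positive,
  \<open>c + 2 * d\<close> lies strictly between \<open>c + d\<close> and its double, hence strictly
  between consecutive powers of two.\<close>

lemma no_progression_of_powers_of_two:
  fixes c d :: nat
  assumes "d > 0" and "\<And>t. \<exists>k. c + t * d = 2 ^ k"
  shows False
proof -
  obtain i j l where i: "c = 2 ^ i" and j: "c + d = 2 ^ j" and l: "c + 2 * d = 2 ^ l"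
    using assms(2)[of 0] assms(2)[of 1] assms(2)[of 2] by auto
  have "(2::nat) ^ j < 2 ^ l" "(2::nat) ^ l < 2 ^ Suc j"
    using assms(1) i zero_less_power[of "2::nat" i] by (simp_all flip: j l)
  then show False
    by (metis less_Suc_eq_le linorder_not_less one_less_numeral_iff power_strict_increasing_iff
        semiring_norm(76))
qed

section \<open>Repeated blocks and the automaton\<close>

lemma word_star_empty: "word_star {} = {[]}"
  by (simp add: word_star_def)

lemma word_star_singleton: "word_star {x} = range (\<lambda>n. concat (replicate n x))"
proof -
  have "xs = replicate (length xs) x" if "xs \<in> lists {x}" for xs
    using that by (intro replicate_eqI) auto
  then have "lists {x} = range (\<lambda>n. replicate n x)"
    by auto
  then show ?thesis
    by (simp add: word_star_def image_image)
qed

abbreviation repeat :: "nat \<Rightarrow> 'a list \<Rightarrow> 'a list" where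
  "repeat n x \<equiv> concat (replicate n x)"

lemma repeat_snoc: "repeat n x @ x @ y = repeat (Suc n) x @ y"
  by (induction n) auto

text \<open>In states 0, 2 and 3 the translucent word is the block that the sweep produces, so
  finished blocks are skipped and the next deletion falls right behind them. State 1 has no
  translucent word and must act on the first letter. States 2 and 3 differ only at the marker, where
  state 2 detects that a single block is left.\<close>

definition halver :: "(nat, nat) rnfawtw" where
  "halver =
     \<lparr>states = {0, 1, 2, 3}, alphabet = {0, 1},
      translucent = (\<lambda>q. if q = 0 then {[0, 1, 0]} else if q = 1 then {} else {[1, 0]}),
      initial = {0},
      delta = (\<lambda>q a. if q = 0 then if a = 1 then {0} else {}
                     else if a = 0 then if q = 1 then {2} else {3} else {}),
      end_delta = (\<lambda>q. if q = 0 then Continue {1} else if q = 1 then Reject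
                       else if q = 2 then Accept else Continue {0})\<rparr>"

lemma halver_sel [simp]:
  "states halver = {0, 1, 2, 3}"
  "alphabet halver = {0, 1}"
  "translucent halver q = (if q = 0 then {[0, 1, 0]} else if q = 1 then {} else {[1, 0]})"
  "initial halver = {0}"
  "delta halver q a = (if q = 0 then if a = 1 then {0} else {}
                       else if a = 0 then if q = 1 then {2} else {3} else {})"
  "end_delta halver q = (if q = 0 then Continue {1} else if q = 1 then Reject
                         else if q = 2 then Accept else Continue {0})"
  by (simp_all add: halver_def)

lemma readable_halver [simp]: "readable halver q = (if q = 0 then {1} else {0})"
  by (auto simp: readable_def)

lemma is_rdfawtw_halver: "is_rdfawtw halver"
  by (auto simp: is_rdfawtw_def is_rnfawtw_def prefix_code_def split: if_splits)

section \<open>Necessary condition for acceptance\<close>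

text \<open>The place of the deletion is forced. Cancelling common blocks ba leaves a word that
  starts with a, so the letter read is the first letter of the first block aba; what remains of that
  block is one more ba.\<close>

lemma second_sweep_read:
  assumes "repeat l [1, 0] @ 0 # v = repeat i [1, 0] @ repeat j [0, 1, 0::nat]"
  shows "\<exists>j'. j = Suc j' \<and> repeat l [1, 0] @ v = repeat (Suc i) [1, 0] @ repeat j' [0, 1, 0]"
  using assms
proof (induction l arbitrary: i)
  case 0
  then show ?case
    by (cases i; cases j) auto
next
  case (Suc l)
  then show ?case
    by (cases i; cases j) auto
qed

text \<open>After common blocks ba are cancelled, a remaining block aba would start with a where the
  left side starts with b or is empty.\<close>

lemma second_sweep_end:
  assumes "repeat l [1, 0] = repeat i [1, 0] @ repeat j [0, 1, 0::nat]"
  shows "j = 0"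
  using assms
proof (induction l arbitrary: i)
  case 0
  then show ?case
    by (cases j) auto
next
  case (Suc l)
  then show ?case
    by (cases i; cases j) auto
qed

lemma count_list_repeat: "count_list (repeat n x) a = n * count_list x a"
  by (induction n) auto

text \<open>A necessary condition for acceptance, to be carried backwards along steps. State 0 has
  to cope with arbitrary tapes, so its clause only counts letters; the other clauses count blocks
  and hold vacuously on tapes of any other shape. The exponent drops from \<open>Suc k\<close> to
  \<open>k\<close> between states 0 and 1 because each block aba contains two letters a.\<close>

definition accepting_invariant :: "(nat, nat) config \<Rightarrow> bool" where
  "accepting_invariant c = (case c of
     Accepted \<Rightarrow> True
   | Rejected \<Rightarrow> False
   | Conf q w \<Rightarrow>
       if q = 0 then \<exists>k. count_list w 0 = 2 ^ Suc k
       else if q = 1 then \<forall>n. w = repeat n [0, 1, 0] \<longrightarrow> (\<exists>k. n = 2 ^ k)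
       else if q = 2 then \<forall>n. w = repeat 1 [1, 0] @ repeat n [0, 1, 0] \<longrightarrow> (\<exists>k. Suc n = 2 ^ k)
       else \<forall>i j. w = repeat i [1, 0] @ repeat j [0, 1, 0] \<longrightarrow> (\<exists>k. i + j = 2 ^ Suc k))"

lemma accepting_invariant_second_sweep:
  assumes "accepting_invariant (Conf 3 w)" and "w = repeat i [1, 0] @ repeat j [0, 1, 0]"
  shows "\<exists>k. i + j = 2 ^ Suc k"
proof -
  have "accepting_invariant (Conf 3 w) \<longleftrightarrow>
      (\<forall>i j. w = repeat i [1, 0] @ repeat j [0, 1, 0] \<longrightarrow> (\<exists>k. i + j = 2 ^ Suc k))"
    by (simp add: accepting_invariant_def)
  then show ?thesis
    using assms by blast
qed

lemma accepting_invariant_step: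
  assumes "step halver c c'" and "accepting_invariant c'"
  shows "accepting_invariant c"
  using assms
proof (cases rule: step.cases)
  case (read_letter q u a v q')
  then consider "q = 0" | "q = 1" | "q = 2" | "q = 3"
    by auto
  then show ?thesis
  proof cases
    case 1
    \<comment> \<open>State 0 deletes only the letter 1, so the count of 0 does not change.\<close>
    then show ?thesis
      using assms(2) read_letter by (auto simp: accepting_invariant_def)
  next
    case 2
    have "\<exists>k. n = 2 ^ k" if "0 # v = repeat n [0, 1, 0]" for n
    \<comment> \<open>Deleting the first letter of (aba)^(m+1) leaves ba(aba)^m, the shape in the
      clause for state 2; \<open>n = 0\<close> would make the tape empty.\<close>
    proof (cases n)
      case (Suc m)
      then show ?thesis
        using that assms(2) read_letter 2 by (auto simp: accepting_invariant_def word_star_empty)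
    qed (use that in auto)
    then show ?thesis
      using read_letter 2 by (auto simp: accepting_invariant_def word_star_empty)
  next
    case 3
    have "a = 0" "q' = 3"
      using read_letter 3 by auto
    obtain l where l: "u = repeat l [1, 0]"
      using read_letter(4) 3 by (auto simp: word_star_singleton)
    have "\<exists>k. Suc n = 2 ^ k" if eq: "u @ a # v = repeat 1 [1, 0] @ repeat n [0, 1, 0]" for n
    proof -
      obtain n' where n': "n = Suc n'" "u @ v = repeat (Suc 1) [1, 0] @ repeat n' [0, 1, 0]"
        using second_sweep_read[OF eq[unfolded l \<open>a = 0\<close>]] unfolding l by blast
      have "\<exists>k. Suc 1 + n' = 2 ^ Suc k"
        using assms(2) n'(2) unfolding read_letter(2) \<open>q' = 3\<close>
        by (rule accepting_invariant_second_sweep)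
      then obtain k where "Suc 1 + n' = 2 ^ Suc k" ..
      then show ?thesis
        using n'(1) by (intro exI[of _ "Suc k"]) simp
    qed
    then show ?thesis
      unfolding read_letter(1) 3 by (simp add: accepting_invariant_def)
  next
    case 4
    have "a = 0" "q' = 3"
      using read_letter 4 by auto
    obtain l where l: "u = repeat l [1, 0]"
      using read_letter(4) 4 by (auto simp: word_star_singleton)
    have "\<exists>k. i + j = 2 ^ Suc k" if eq: "u @ a # v = repeat i [1, 0] @ repeat j [0, 1, 0]" for i j
    proof -
      obtain j' where j': "j = Suc j'" "u @ v = repeat (Suc i) [1, 0] @ repeat j' [0, 1, 0]"
        using second_sweep_read[OF eq[unfolded l \<open>a = 0\<close>]] unfolding l by blast
      have "\<exists>k. Suc i + j' = 2 ^ Suc k"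
        using assms(2) j'(2) unfolding read_letter(2) \<open>q' = 3\<close>
        by (rule accepting_invariant_second_sweep)
      then show ?thesis
        using j'(1) by simp
    qed
    then show ?thesis
      unfolding read_letter(1) 4 by (simp add: accepting_invariant_def)
  qed
next
  case (end_accept q w)
  then have "q = 2"
    by (auto split: if_splits)
  then obtain l where l: "w = repeat l [1, 0]"
    using end_accept by (auto simp: word_star_singleton)
  have "n = 0" if "w = repeat 1 [1, 0] @ repeat n [0, 1, 0]" for n
    using second_sweep_end[of l 1 n] that unfolding l by simp
  \<comment> \<open>Acceptance happens on one block only, whence the exponent 0.\<close>
  then have "\<exists>k. Suc n = 2 ^ k" if "w = repeat 1 [1, 0] @ repeat n [0, 1, 0]" for n
    using that by (intro exI[of _ 0]) simp
  then show ?thesis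
    unfolding end_accept(1) \<open>q = 2\<close> by (simp add: accepting_invariant_def)
next
  case (end_continue q w S q')
  then consider "q = 0" "q' = 1" | "q = 3" "q' = 0"
    by (auto split: if_splits)
  then show ?thesis
  proof cases
    case 1
    obtain n where n: "w = repeat n [0, 1, 0]"
      using end_continue(4) 1 by (auto simp: word_star_singleton)
    then obtain k where "n = 2 ^ k"
      using assms(2) unfolding end_continue(2) 1 by (auto simp: accepting_invariant_def)
    \<comment> \<open>State 0 is left only on (aba)^n, which has 2n letters 0; this is where the
      doubling enters.\<close>
    then have "count_list w 0 = 2 ^ Suc k"
      unfolding n by (simp add: count_list_repeat)
    then show ?thesis
      unfolding end_continue(1) 1 by (auto simp: accepting_invariant_def)
  next
    case 2
    obtain l where l: "w = repeat l [1, 0]"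
      using end_continue(4) 2 by (auto simp: word_star_singleton)
    have "\<exists>k. i + j = 2 ^ Suc k" if "w = repeat i [1, 0] @ repeat j [0, 1, 0]" for i j
    proof -
      have "j = 0"
        using second_sweep_end[of l i j] that l by simp
      \<comment> \<open>Each block ba has one letter 0, so the block count becomes the letter count
        for the next round.\<close>
      then have "count_list w 0 = i + j"
        using that by (simp add: count_list_repeat)
      then show ?thesis
        using assms(2) unfolding end_continue(2) 2 by (auto simp: accepting_invariant_def)
    qed
    then show ?thesis
      unfolding end_continue(1) 2 by (simp add: accepting_invariant_def)
  qed
\<comment> \<open>The remaining steps lead to \<open>Rejected\<close>, where the condition is
  false.\<close>
qed (auto simp: accepting_invariant_def)

text \<open>The condition holds at \<open>Accepted\<close> and is pulled back along the whole run to
  state 0.\<close>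

lemma count_accepted:
  assumes "w \<in> language halver"
  shows "\<exists>k. count_list w 0 = 2 ^ k"
proof -
  have "(step halver)\<^sup>*\<^sup>* (Conf 0 w) Accepted"
    using assms by (simp add: language_def)
  then have "accepting_invariant (Conf 0 w)"
    by (induction rule: converse_rtranclp_induct)
      (auto simp: accepting_invariant_def[of Accepted] intro: accepting_invariant_step)
  then show ?thesis
    by (auto simp: accepting_invariant_def simp del: power_Suc)
qed

section \<open>Accepting runs on powers of ba\<close>

lemma repeat_in_lists: "x \<in> lists S \<Longrightarrow> repeat n x \<in> lists S"
  by (induction n) auto

text \<open>Two blocks ba ba read as b followed by aba, so one deletion turns them into a finished
  block. The prefix of \<open>i\<close> finished blocks makes the induction go through.\<close>

lemma first_sweep:
  "(step halver)\<^sup>*\<^sup>* (Conf 0 (repeat i [0, 1, 0] @ repeat (2 * j) [1, 0])) (Conf 1 (repeat (i + j) [0, 1, 0]))"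
proof (induction j arbitrary: i)
  case 0
  have "step halver (Conf 0 (repeat i [0, 1, 0])) (Conf 1 (repeat i [0, 1, 0]))"
    by (rule step.end_continue[where S = "{1}"]) (auto simp: word_star_singleton)
  then show ?case
    by auto
next
  case (Suc j)
  let ?v = "[0, 1, 0] @ repeat (2 * j) [1, 0]"
  have "step halver (Conf 0 (repeat i [0, 1, 0] @ 1 # ?v)) (Conf 0 (repeat i [0, 1, 0] @ ?v))"
    by (rule step.read_letter) (auto simp: word_star_singleton split: if_splits)
  then have "(step halver)\<^sup>*\<^sup>* (Conf 0 (repeat i [0, 1, 0] @ 1 # ?v)) (Conf 1 (repeat (Suc i + j) [0, 1, 0]))"
    using Suc[of "Suc i"] unfolding repeat_snoc by (rule converse_rtranclp_into_rtranclp)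
  then show ?case
    by simp
qed

lemma second_sweep:
  "(step halver)\<^sup>*\<^sup>* (Conf 3 (repeat i [1, 0] @ repeat j [0, 1, 0])) (Conf 0 (repeat (i + j) [1, 0]))"
proof (induction j arbitrary: i)
  case 0
  have "step halver (Conf 3 (repeat i [1, 0])) (Conf 0 (repeat i [1, 0]))"
    by (rule step.end_continue[where S = "{0}"]) (auto simp: word_star_singleton)
  then show ?case
    by auto
next
  case (Suc j)
  let ?v = "[1, 0] @ repeat j [0, 1, 0]"
  have "step halver (Conf 3 (repeat i [1, 0] @ 0 # ?v)) (Conf 3 (repeat i [1, 0] @ ?v))"
    by (rule step.read_letter) (auto simp: word_star_singleton split: if_splits)
  then have "(step halver)\<^sup>*\<^sup>* (Conf 3 (repeat i [1, 0] @ 0 # ?v)) (Conf 0 (repeat (Suc i + j) [1, 0]))"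
    using Suc[of "Suc i"] unfolding repeat_snoc by (rule converse_rtranclp_into_rtranclp)
  then show ?case
    by simp
qed

lemma start_second_sweep:
  "step halver (Conf 1 (repeat (Suc n) [0, 1, 0])) (Conf 2 (repeat 1 [1, 0] @ repeat n [0, 1, 0]))"
  using step.read_letter[of 1 halver "[]" 0 "repeat 1 [1, 0] @ repeat n [0, 1, 0]" 2]
    repeat_in_lists[of "[0, 1, 0]" "{0, 1::nat}" n]
  by (simp add: word_star_empty)

text \<open>Past the skipped ba, state 2 meets a further block; it therefore moves to state 3 rather
  than accepting at the marker.\<close>

lemma continue_second_sweep:
  "step halver (Conf 2 (repeat 1 [1, 0] @ repeat (Suc n) [0, 1, 0])) (Conf 3 (repeat 2 [1, 0] @ repeat n [0, 1, 0]))"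
proof -
  have "[1, 0] \<in> word_star {[1, 0::nat]}"
    unfolding word_star_singleton by (rule range_eqI[of _ _ 1]) simp
  then show ?thesis
    using step.read_letter[of 2 halver "[1, 0]" 0 "[1, 0] @ repeat n [0, 1, 0]" 3]
      repeat_in_lists[of "[0, 1, 0]" "{0, 1::nat}" n]
    by (simp add: numeral_2_eq_2)
qed

lemma accept_single_block: "step halver (Conf 2 (repeat 1 [1, 0] @ repeat 0 [0, 1, 0])) Accepted"
proof -
  have "[1, 0] \<in> word_star {[1, 0::nat]}"
    unfolding word_star_singleton by (rule range_eqI[of _ _ 1]) simp
  then show ?thesis
    by (intro step.end_accept) auto
qed

lemma accepts_power_of_two: "(step halver)\<^sup>*\<^sup>* (Conf 0 (repeat (2 ^ Suc k) [1, 0])) Accepted"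
proof (induction k)
  case 0
  have "(step halver)\<^sup>*\<^sup>* (Conf 0 (repeat (2 ^ Suc 0) [1, 0])) (Conf 1 (repeat (Suc 0) [0, 1, 0]))"
    using first_sweep[of 0 1] by simp
  then show ?case
    using start_second_sweep[of 0] accept_single_block by (meson rtranclp.rtrancl_into_rtrancl)
next
  case (Suc k)
  \<comment> \<open>At least two blocks aba reach state 1, one for each of the deletions in states 1
    and 2; state 3 handles the other \<open>n\<close>.\<close>
  obtain n where n: "(2::nat) ^ Suc k = Suc (Suc n)"
    by (metis One_nat_def Suc_pred' add_2_eq_Suc le_add_diff_inverse power_Suc dvd_imp_le
        dvd_triv_left zero_less_numeral zero_less_power)
  have "(step halver)\<^sup>*\<^sup>* (Conf 0 (repeat (2 ^ Suc (Suc k)) [1, 0])) (Conf 1 (repeat (Suc (Suc n)) [0, 1, 0]))"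
    using first_sweep[of 0 "Suc (Suc n)"] unfolding power_Suc[of 2 "Suc k"] n
    by (simp del: replicate_Suc)
  moreover have "(step halver)\<^sup>*\<^sup>* (Conf 3 (repeat 2 [1, 0] @ repeat n [0, 1, 0])) (Conf 0 (repeat (2 ^ Suc k) [1, 0]))"
    using second_sweep[of 2 n] n by simp
  ultimately show ?case
    using start_second_sweep[of "Suc n"] continue_second_sweep[of n] Suc
    by (meson rtranclp.rtrancl_into_rtrancl rtranclp_trans)
qed

section \<open>Failure of semi-linearity\<close>

lemma not_semilinear_halver: "\<not> semilinear_language {0, 1} (language halver)"
proof
  assume semilinear: "semilinear_language {0, 1} (language halver)"
  \<comment> \<open>The accepted powers of ba give infinitely many counts of 0, as the progression
    lemma requires; \<open>count_accepted\<close> then forces every term of the progression to be a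
    power of two.\<close>
  have "range (\<lambda>k. 2 ^ Suc k) \<subseteq> (\<lambda>v. v 0) ` parikh ` language halver"
  proof clarify
    fix k :: nat
    have "repeat (2 ^ Suc k) [1, 0] \<in> language halver"
      using accepts_power_of_two[of k] repeat_in_lists[of "[1, 0]" "{0, 1::nat}"]
      by (simp add: language_def del: power_Suc)
    moreover have "2 ^ Suc k = parikh (repeat (2 ^ Suc k) [1, 0::nat]) 0"
      by (simp add: parikh_def count_list_repeat)
    ultimately show "2 ^ Suc k \<in> (\<lambda>v. v 0) ` parikh ` language halver"
      by blast
  qed
  moreover have "infinite (range (\<lambda>k. 2 ^ Suc k :: nat))"
    using finite_imageD[of "\<lambda>k. 2 ^ Suc k :: nat" UNIV] by (auto simp: inj_def)
  ultimately have "infinite ((\<lambda>v. v 0) ` parikh ` language halver)"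
    using infinite_super by blast
  with semilinear obtain c d :: nat where "d > 0" "\<forall>t. c + t * d \<in> (\<lambda>v. v 0) ` parikh ` language halver"
    using semilinear_set_imp_progression[of "{0, 1}" "parikh ` language halver" 0]
    unfolding semilinear_language_def by blast
  moreover from this have "\<exists>k. c + t * d = 2 ^ k" for t
    using count_accepted by (fastforce simp: parikh_def)
  ultimately show False
    using no_progression_of_powers_of_two by blast
qed

theorem theorem15:
  shows "\<exists>A :: (nat, nat) rnfawtw.
    is_rdfawtw A \<and> card (alphabet A) = 2 \<and> \<not> semilinear_language (alphabet A) (language A)"
proof (intro exI conjI)
  show "is_rdfawtw halver"
    by (fact is_rdfawtw_halver)
  show "card (alphabet halver) = 2"
    by simp
  show "\<not> semilinear_language (alphabet halver) (language halver)"
    using not_semilinear_halver by simp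
qed

end
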